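(* Let $n\ge4$ and let $\mathcal{H}$ be the irreducible representation of $\mathfrak{su}(2)$ of dimension $n+1$, with its $\mathfrak{su}(2)$ quantum metric $\mathcal{E}_t$ and orthonormal weight basis $\{|k\rangle : -n\le k\le n,\ k\equiv n \bmod 2\}$. For $k$ with $4\le k\le n$, $k\equiv n\bmod 2$, let $\mathcal{C}_k$ be the span of $$|\psi_1^{(k)}\rangle=\sqrt{\tfrac{k}{2k-2}}\,|-(k-2)\rangle-\sqrt{\tfrac{k-2}{2k-2}}\,|k\rangle,\qquad |\psi_2^{(k)}\rangle=\sqrt{\tfrac{k-2}{2k-2}}\,|-k\rangle+\sqrt{\tfrac{k}{2k-2}}\,|k-2\rangle,$$ and let $|\phi_3\rangle=\frac1{\sqrt2}(|3\rangle+|-3\rangle)$. Define $$\mathcal{C}=\begin{cases}\operatorname{span}(\mathcal{C}_n,\mathcal{C}_{n-6},\dots,\mathcal{C}_6,\{|0\rangle\})& n\equiv0\pmod 6\\ \operatorname{span}(\mathcal{C}_n,\mathcal{C}_{n-6},\dots,\mathcal{C}_7)& n\equiv1\pmod 6\\ \operatorname{span}(\mathcal{C}_n,\mathcal{C}_{n-6},\dots,\mathcal{C}_8,\{|0\rangle\})& n\equiv2\pmod 6\\ \operatorname{span}(\mathcal{C}_n,\mathcal{C}_{n-6},\dots,\mathcal{C}_9,\{|\phi_3\rangle\})& n\equiv3\pmod 6\\ \operatorname{span}(\mathcal{C}_n,\mathcal{C}_{n-6},\dots,\mathcal{C}_4)& n\equiv4\pmod 6\\ \operatorname{span}(\mathcal{C}_n,\mathcal{C}_{n-6},\dots,\mathcal{C}_5)&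 n\equiv5\pmod 6.\end{cases}$$ Then $\mathcal{C}$ is a quantum code of distance $2$, and $$\dim(\mathcal{C})=2\left(\tfrac n6\right)+1,\quad 2\left(\tfrac{n-1}6\right),\quad 2\left(\tfrac{n-2}6\right)+1,\quad 2\left(\tfrac{n-3}6\right)+1,\quad 2\left(\tfrac{n+2}6\right),\quad 2\left(\tfrac{n+1}6\right)$$ for $n\equiv0,1,2,3,4,5\pmod 6$ respectively.
   Context: The $\mathfrak{su}(2)$ quantum metric: the operators $E,F,H$ (images of the standard basis of $\mathfrak{sl}(2)$) act on $\mathcal{H}$ by $H|k\rangle=k|k\rangle$, $E|k\rangle=\sqrt{\frac{(n-k)(n+k+2)}4}\,|k+2\rangle$ (zero if $k=n$), $F|k\rangle=\sqrt{\frac{(n-k+2)(n+k)}4}\,|k-2\rangle$ (zero if $k=-n$). Let $\mathcal{E}=\operatorname{span}\{I_{\mathcal{H}},E,F,H\}$, $\mathcal{E}_t=\mathbb{C}I_{\mathcal{H}}$ for $0\le t<1$, and $\mathcal{E}_t=\mathcal{E}^{\lfloor t\rfloor}$ (span of products of $\lfloor t\rfloor$ elements of $\mathcal{E}$) for $t\ge1$. A quantum code is a subspace $\mathcal{C}\subseteq\mathcal{H}$ with orthogonal projection $P$; it detects an operator $A$ if $PAP$ is a scalar multiple of $P$; its distance is the largest $d$ such that it detects all $A\in\mathcal{E}_{d-1}$. *)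

theory Defs
  imports "Jordan_Normal_Form.Schur_Decomposition" "Jordan_Normal_Form.VS_Connect"
begin

text \<open>
  The irreducible representation of highest weight \<open>n\<close> is realised on \<open>\<complex>\<^sup>n\<^sup>+\<^sup>1\<close> with its standard
  Hermitian inner product; coordinate \<open>i \<in> {0, \<dots>, n}\<close> belongs to the weight \<open>2 i - n\<close>.
\<close>

abbreviation hilb :: "nat \<Rightarrow> (complex, complex vec) module"
  where "hilb n \<equiv> module_vec TYPE(complex) (n + 1)"

abbreviation ops :: "nat \<Rightarrow> (complex, complex mat) module"
  where "ops n \<equiv> module_mat TYPE(complex) (n + 1) (n + 1)"

abbreviation vspan :: "nat \<Rightarrow> complex vec set \<Rightarrow> complex vec set"
  where "vspan n \<equiv> LinearCombinations.module.span class_ring (hilb n)"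

abbreviation opspan :: "nat \<Rightarrow> complex mat set \<Rightarrow> complex mat set"
  where "opspan n \<equiv> LinearCombinations.module.span class_ring (ops n)"

abbreviation subdim :: "nat \<Rightarrow> complex vec set \<Rightarrow> nat"
  where "subdim n C \<equiv> vectorspace.dim class_ring ((hilb n)\<lparr>carrier := C\<rparr>)"

definition weight :: "nat \<Rightarrow> nat \<Rightarrow> int"
  where "weight n i = 2 * int i - int n"

text \<open>\<open>ket n k\<close> is the zero vector when \<open>k\<close> is not a weight.\<close>

definition ket :: "nat \<Rightarrow> int \<Rightarrow> complex vec"
  where "ket n k = vec (n + 1) (\<lambda>i. if weight n i = k then 1 else 0)"

text \<open>The linear operator sending \<open>ket n k\<close> to \<open>f k\<close> for every weight \<open>k\<close>.\<close>

definition op_on_kets :: "nat \<Rightarrow> (int \<Rightarrow> complex vec) \<Rightarrow> complex mat"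
  where "op_on_kets n f = mat_of_cols (n + 1) (map (\<lambda>i. f (weight n i)) [0..<n + 1])"

definition H_op :: "nat \<Rightarrow> complex mat"
  where "H_op n = op_on_kets n (\<lambda>k. of_int k \<cdot>\<^sub>v ket n k)"

definition E_op :: "nat \<Rightarrow> complex mat"
  where "E_op n = op_on_kets n (\<lambda>k. if k = int n then 0\<^sub>v (n + 1)
    else complex_of_real (sqrt (real_of_int ((int n - k) * (int n + k + 2)) / 4)) \<cdot>\<^sub>v ket n (k + 2))"

definition F_op :: "nat \<Rightarrow> complex mat"
  where "F_op n = op_on_kets n (\<lambda>k. if k = - int n then 0\<^sub>v (n + 1)
    else complex_of_real (sqrt (real_of_int ((int n - k + 2) * (int n + k)) / 4)) \<cdot>\<^sub>v ket n (k - 2))"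

lemma op_on_kets_ket:
  assumes "i \<le> n" and f: "\<And>k. f k \<in> carrier_vec (n + 1)"
  shows "op_on_kets n f *\<^sub>v ket n (weight n i) = f (weight n i)"
proof -
  have "ket n (weight n i) = unit_vec (n + 1) i"
    by (auto simp: ket_def weight_def unit_vec_def)
  moreover have "op_on_kets n f \<in> carrier_mat (n + 1) (n + 1)"
    by (simp add: op_on_kets_def carrier_matI)
  ultimately have "op_on_kets n f *\<^sub>v ket n (weight n i) = col (op_on_kets n f) i"
    using assms(1) by (intro eq_vecI) (auto simp: scalar_prod_right_unit)
  also have "\<dots> = f (weight n i)"
    using assms by (simp add: op_on_kets_def col_mat_of_cols del: upt_Suc)
  finally show ?thesis .
qed

definition qm_gen :: "nat \<Rightarrow> complex mat set"
  where "qm_gen n = opspan n {1\<^sub>m (n + 1), E_op n, F_op n, H_op n}"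

text \<open>The quantum metric \<open>\<E>\<^sub>t\<close>; only \<open>t \<ge> 0\<close> is meaningful.\<close>

definition quantum_metric :: "nat \<Rightarrow> real \<Rightarrow> complex mat set"
  where "quantum_metric n t =
    (if t < 1 then opspan n {1\<^sub>m (n + 1)}
     else opspan n {foldr (*) As (1\<^sub>m (n + 1)) | As. length As = nat \<lfloor>t\<rfloor> \<and> set As \<subseteq> qm_gen n})"

definition quantum_code :: "nat \<Rightarrow> complex vec set \<Rightarrow> bool"
  where "quantum_code n C \<longleftrightarrow> VectorSpace.subspace class_ring C (hilb n)"

definition orth_projection :: "nat \<Rightarrow> complex vec set \<Rightarrow> complex mat \<Rightarrow> bool"
  where "orth_projection n C P \<longleftrightarrow>
    P \<in> carrier_mat (n + 1) (n + 1) \<and> P * P = P \<and> mat_adjoint P = P \<and>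
    (\<lambda>v. P *\<^sub>v v) ` carrier_vec (n + 1) = C"

text \<open>The existential over \<open>P\<close> is harmless: the orthogonal projection onto a subspace is unique.\<close>

definition detects :: "nat \<Rightarrow> complex vec set \<Rightarrow> complex mat \<Rightarrow> bool"
  where "detects n C A \<longleftrightarrow> (\<exists>P. orth_projection n C P \<and> (\<exists>c. P * A * P = c \<cdot>\<^sub>m P))"

text \<open>
  Distances are positive integers: \<open>\<E>\<^sub>t\<close> depends on \<open>\<lfloor>t\<rfloor>\<close> only, so among real \<open>d\<close> no largest one
  would exist. A code that detects every \<open>\<E>\<^sub>t\<close> has no distance in this sense.
\<close>

definition has_distance :: "nat \<Rightarrow> complex vec set \<Rightarrow> nat \<Rightarrow> bool"
  where "has_distance n C d \<longleftrightarrow>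
    d \<ge> 1 \<and> (\<forall>A \<in> quantum_metric n (real d - 1). detects n C A) \<and>
    (\<forall>d' \<ge> 1. (\<forall>A \<in> quantum_metric n (real d' - 1). detects n C A) \<longrightarrow> d' \<le> d)"

definition psi1 :: "nat \<Rightarrow> int \<Rightarrow> complex vec"
  where "psi1 n k =
    complex_of_real (sqrt (real_of_int k / real_of_int (2 * k - 2))) \<cdot>\<^sub>v ket n (- (k - 2))
    - complex_of_real (sqrt (real_of_int (k - 2) / real_of_int (2 * k - 2))) \<cdot>\<^sub>v ket n k"

definition psi2 :: "nat \<Rightarrow> int \<Rightarrow> complex vec"
  where "psi2 n k =
    complex_of_real (sqrt (real_of_int (k - 2) / real_of_int (2 * k - 2))) \<cdot>\<^sub>v ket n (- k)
    + complex_of_real (sqrt (real_of_int k / real_of_int (2 * k - 2))) \<cdot>\<^sub>v ket n (k - 2)"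

definition phi3 :: "nat \<Rightarrow> complex vec"
  where "phi3 n = complex_of_real (1 / sqrt 2) \<cdot>\<^sub>v (ket n 3 + ket n (- 3))"

definition block :: "nat \<Rightarrow> int \<Rightarrow> complex vec set"
  where "block n k = vspan n {psi1 n k, psi2 n k}"

text \<open>The union of the blocks with indices \<open>n, n - 6, \<dots>, m\<close>, where \<open>m \<equiv> n (mod 6)\<close>.\<close>

definition blocks_down_to :: "nat \<Rightarrow> int \<Rightarrow> complex vec set"
  where "blocks_down_to n m = (\<Union>k \<in> {k. m \<le> k \<and> k \<le> int n \<and> k mod 6 = int n mod 6}. block n k)"

definition su2_code :: "nat \<Rightarrow> complex vec set"
  where "su2_code n =
    (if n mod 6 = 0 then vspan n (blocks_down_to n 6 \<union> {ket n 0})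
     else if n mod 6 = 1 then vspan n (blocks_down_to n 7)
     else if n mod 6 = 2 then vspan n (blocks_down_to n 8 \<union> {ket n 0})
     else if n mod 6 = 3 then vspan n (blocks_down_to n 9 \<union> {phi3 n})
     else if n mod 6 = 4 then vspan n (blocks_down_to n 4)
     else vspan n (blocks_down_to n 5))"

end

(*
  Every spanning vector is a combination of two kets. Vectors from different blocks have supports
  more than 2 apart, so E, F and H have no matrix elements between them. Inside a block the
  amplitudes make the expectation of H vanish, and the two contributions to the only nontrivial
  matrix element of E (or F) cancel because E carries the same coefficient at the weights -k and
  k - 2. Hence the projection P satisfies PEP = PFP = PHP = 0. The distance is not larger than 2
  since HE has a nonzero matrix element between the orthogonal vectors of the top block.
*)
theory Submission
  imports Defs "Jordan_Normal_Form.DL_Rank"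
begin

text \<open>Vanishing expectation of \<open>H\<close> forces the squared amplitudes at the weights
  \<open>2 - k\<close> and \<open>k\<close> into the ratio \<open>k : k - 2\<close>, and norm 1 then
  gives the square roots in \<open>psi1\<close>; up to sign, \<open>psi2\<close> is its mirror image
  under negation of weights. The block at \<open>k\<close> occupies the absolute weights
  \<open>k - 2\<close> and \<open>k\<close>, so steps of 6 leave gaps of 4, and the room around
  weight 0 may admit one further vector. The condition \<open>4 \<le> k\<close> keeps
  \<open>2 - k\<close> and \<open>k - 2\<close> at least 4 apart, so a shift by 2 joins only
  \<open>- k\<close> to \<open>2 - k\<close> and \<open>k - 2\<close> to \<open>k\<close>; the minus
  sign in \<open>psi1\<close> makes the two contributions opposite. \<open>H\<close> multiplies them
  by the weights \<open>2 - k\<close> and \<open>k\<close>, which have opposite signs, so in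
  \<open>HE\<close> they add up instead of cancelling. All amplitudes are real, so every condition
  becomes real arithmetic on tuples \<open>(a, k, b, l)\<close>. The six residue classes differ only
  in the lowest block, the number of blocks and the extra vector, and share one locale.\<close>

text \<open>Otherwise the simplifier turns the dimension \<open>n + 1\<close> into \<open>Suc n\<close>.\<close>

declare One_nat_def [simp del]

section \<open>Codes spanned by orthonormal families\<close>

lemma dim_mat_adjoint [simp]:
  "dim_row (mat_adjoint A) = dim_col A" "dim_col (mat_adjoint A) = dim_row A"
  by (auto simp: mat_adjoint_def)

lemma mat_adjoint_carrier [simp]:
  "A \<in> carrier_mat r c \<Longrightarrow> mat_adjoint A \<in> carrier_mat c r"
  by (intro carrier_matI) auto

lemma mat_adjoint_index:
  assumes "A \<in> carrier_mat r c" "i < c" "j < r"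
  shows "mat_adjoint A $$ (i, j) = conjugate (A $$ (j, i))"
  using assms by (auto simp: mat_adjoint_def mat_of_rows_index)

lemma mat_adjoint_gram:
  fixes B :: "complex mat"
  assumes "B \<in> carrier_mat r c"
  shows "mat_adjoint (B * mat_adjoint B) = B * mat_adjoint B"
proof (rule eq_matI)
  note BB = mult_carrier_mat[OF assms mat_adjoint_carrier[OF assms]]
  fix i j assume "i < dim_row (B * mat_adjoint B)" "j < dim_col (B * mat_adjoint B)"
  then have ij: "i < r" "j < r" using BB by auto
  have entry: "(B * mat_adjoint B) $$ (i, j) = (\<Sum>k = 0..<c. B $$ (i, k) * cnj (B $$ (j, k)))"
    if "i < r" "j < r" for i j
    using that assms
    by (simp add: scalar_prod_def mat_adjoint_index[OF assms])
  show "mat_adjoint (B * mat_adjoint B) $$ (i, j) = (B * mat_adjoint B) $$ (i, j)"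
    using ij by (simp add: mat_adjoint_index[OF BB] entry mult.commute)
qed (use assms mat_adjoint_carrier[OF mult_carrier_mat[OF assms mat_adjoint_carrier[OF assms]]] in auto)

lemma mat_adjoint_scalar_prod:
  fixes P :: "complex mat"
  assumes "P \<in> carrier_mat N N" "v \<in> carrier_vec N" "w \<in> carrier_vec N"
  shows "(P *\<^sub>v v) \<bullet>c w = v \<bullet>c (mat_adjoint P *\<^sub>v w)"
proof -
  have "(P *\<^sub>v v) \<bullet>c w = (\<Sum>i = 0..<N. (\<Sum>j = 0..<N. P $$ (i, j) * v $ j) * cnj (w $ i))"
    using assms by (simp add: scalar_prod_def)
  also have "\<dots> = (\<Sum>j = 0..<N. v $ j * (\<Sum>i = 0..<N. P $$ (i, j) * cnj (w $ i)))"
    unfolding sum_distrib_left sum_distrib_right by (subst sum.swap) (simp add: mult_ac)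
  also have "\<dots> = v \<bullet>c (mat_adjoint P *\<^sub>v w)"
    using assms
    by (simp add: scalar_prod_def mat_adjoint_index[OF assms(1)] sum_conjugate)
  finally show ?thesis .
qed

text \<open>Translates a condition on the compressed operator into one inner product per pair of
  columns, the form in which detection is verified later.\<close>

lemma compression_index:
  fixes A B :: "complex mat"
  assumes B: "B \<in> carrier_mat r c" and A: "A \<in> carrier_mat r r" and ij: "i < c" "j < c"
  shows "(mat_adjoint B * (A * B)) $$ (i, j) = (A *\<^sub>v col B j) \<bullet>c col B i"
proof -
  have "col (A * B) j = A *\<^sub>v col B j"
    by (rule col_mult2[OF A B ij(2)])
  moreover have "row (mat_adjoint B) i = conjugate (col B i)"
    using B ij by (auto simp: mat_adjoint_def)
  moreover have "conjugate (col B i) \<bullet> (A *\<^sub>v col B j) = (A *\<^sub>v col B j) \<bullet>c col B i"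
    using A B ij by (intro comm_scalar_prod[of _ r]) auto
  ultimately show ?thesis
    using A B ij mat_adjoint_carrier[OF B] by simp
qed

text \<open>The columns of \<open>B\<close> are an orthonormal basis of the code, which makes
  \<open>B * mat_adjoint B\<close> its orthogonal projection and reduces \<open>P * A * P\<close> to
  the \<open>m\<close> by \<open>m\<close> matrix \<open>mat_adjoint B * (A * B)\<close>.\<close>

locale isometry =
  fixes n m :: nat and B :: "complex mat"
  assumes B: "B \<in> carrier_mat (n + 1) m"
    and gram: "mat_adjoint B * B = 1\<^sub>m m"
begin

interpretation V: vec_space "TYPE(complex)" "n + 1" .

lemma adj: "mat_adjoint B \<in> carrier_mat m (n + 1)"
  using B by simp

lemma left_inverse:
  assumes "v \<in> carrier_vec m"
  shows "mat_adjoint B *\<^sub>v (B *\<^sub>v v) = v"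
  using assoc_mult_mat_vec[OF adj B assms] assms gram by simp

lemma range_eq: "vspan n (set (cols B)) = (\<lambda>v. B *\<^sub>v v) ` carrier_vec m"
proof -
  have "vspan n (set (cols B)) = V.col_space B" by (simp add: V.col_space_def)
  also have "\<dots> = (\<lambda>v. B *\<^sub>v v) ` carrier_vec m"
    unfolding V.col_space_eq[OF B] using B by auto
  finally show ?thesis .
qed

text \<open>Idempotence is the Gram identity in the middle of the fourfold product; the range is
  that of \<open>B\<close> because every \<open>B *\<^sub>v v\<close> is fixed.\<close>

lemma projection: "orth_projection n (vspan n (set (cols B))) (B * mat_adjoint B)"
proof -
  have "B * mat_adjoint B * (B * mat_adjoint B) = B * (mat_adjoint B * B * mat_adjoint B)"
    using assoc_mult_mat[OF B adj mult_carrier_mat[OF B adj]] assoc_mult_mat[OF adj B adj]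
    by (simp del: assoc_mult_mat)
  then have idem: "B * mat_adjoint B * (B * mat_adjoint B) = B * mat_adjoint B"
    using left_mult_one_mat[OF adj] by (simp add: gram)
  have range: "(\<lambda>v. B * mat_adjoint B *\<^sub>v v) ` carrier_vec (n + 1) = (\<lambda>v. B *\<^sub>v v) ` carrier_vec m"
  proof (intro equalityI subsetI)
    fix w assume "w \<in> (\<lambda>v. B * mat_adjoint B *\<^sub>v v) ` carrier_vec (n + 1)"
    then show "w \<in> (\<lambda>v. B *\<^sub>v v) ` carrier_vec m"
      using mult_mat_vec_carrier[OF adj] by (auto simp: assoc_mult_mat_vec[OF B adj])
  next
    fix w assume "w \<in> (\<lambda>v. B *\<^sub>v v) ` carrier_vec m"
    then obtain v where v: "v \<in> carrier_vec m" "w = B *\<^sub>v v" by auto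
    then have "w = B * mat_adjoint B *\<^sub>v (B *\<^sub>v v)"
      using B by (simp add: assoc_mult_mat_vec[OF B adj] left_inverse)
    then show "w \<in> (\<lambda>v. B * mat_adjoint B *\<^sub>v v) ` carrier_vec (n + 1)"
      using B v by auto
  qed
  then show ?thesis
    unfolding orth_projection_def range_eq
    using range idem mat_adjoint_gram[OF B] mult_carrier_mat[OF B adj] by simp
qed

text \<open>Regrouping \<open>P * A * P\<close> puts the compression between \<open>B\<close> and
  \<open>mat_adjoint B\<close>; a scalar there comes out as a factor of \<open>P\<close>.\<close>

lemma detectsI:
  assumes A: "A \<in> carrier_mat (n + 1) (n + 1)"
    and c: "mat_adjoint B * (A * B) = c \<cdot>\<^sub>m 1\<^sub>m m"
  shows "detects n (vspan n (set (cols B))) A"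
proof -
  have AB: "A * B \<in> carrier_mat (n + 1) m" using A B by auto
  have "B * mat_adjoint B * A * (B * mat_adjoint B) = B * mat_adjoint B * (A * (B * mat_adjoint B))"
    by (rule assoc_mult_mat[OF mult_carrier_mat[OF B adj] A mult_carrier_mat[OF B adj]])
  also have "A * (B * mat_adjoint B) = A * B * mat_adjoint B"
    by (rule assoc_mult_mat[OF A B adj, symmetric])
  also have "B * mat_adjoint B * (A * B * mat_adjoint B) = B * (mat_adjoint B * (A * B * mat_adjoint B))"
    by (rule assoc_mult_mat[OF B adj mult_carrier_mat[OF AB adj]])
  also have "mat_adjoint B * (A * B * mat_adjoint B) = mat_adjoint B * (A * B) * mat_adjoint B"
    by (rule assoc_mult_mat[OF adj AB adj, symmetric])
  also have "\<dots> = c \<cdot>\<^sub>m mat_adjoint B"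
    by (simp add: c mult_smult_assoc_mat[OF one_carrier_mat adj] left_mult_one_mat[OF adj])
  also have "B * (c \<cdot>\<^sub>m mat_adjoint B) = c \<cdot>\<^sub>m (B * mat_adjoint B)"
    by (rule mult_smult_distrib[OF B adj])
  finally show ?thesis
    unfolding detects_def using projection by blast
qed

text \<open>\<open>set (cols B)\<close> would merge equal columns; distinctness lets the rank count
  all \<open>m\<close> of them.\<close>

lemma distinct_cols: "distinct (cols B)"
proof (rule corthogonal_distinct, rule corthogonalI)
  fix i j assume "i < length (cols B)" "j < length (cols B)"
  then have ij: "i < m" "j < m" using B by auto
  have "(mat_adjoint B * B) $$ (j, i) = col B i \<bullet>c col B j"
    using compression_index[OF B one_carrier_mat ij(2,1)] B ij by simp
  then show "cols B ! i \<bullet>c cols B ! j = 0 \<longleftrightarrow> i \<noteq> j"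
    using B ij by (auto simp: gram)
qed

text \<open>A linear dependence of the columns is a nonzero kernel vector of \<open>B\<close>,
  impossible because \<open>mat_adjoint B\<close> is a left inverse.\<close>

lemma dim_range: "subdim n (vspan n (set (cols B))) = m"
proof -
  have "V.lin_indpt (set (cols B))"
  proof
    assume "V.lin_dep (set (cols B))"
    from V.lin_depE[OF B this distinct_cols] obtain v
      where v: "v \<in> carrier_vec m" "v \<noteq> 0\<^sub>v m" "B *\<^sub>v v = 0\<^sub>v (n + 1)" by blast
    have "mat_adjoint B *\<^sub>v 0\<^sub>v (n + 1) = 0\<^sub>v m"
      using adj by (intro eq_vecI) (auto simp: scalar_prod_def)
    with left_inverse[OF v(1)] v(2,3) show False by simp
  qed
  then show ?thesis
    using V.lin_indpt_full_rank[OF B distinct_cols] by (simp add: V.rank_def)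
qed

end

text \<open>Indexing the vectors by \<open>I\<close> makes the dimension \<open>card I\<close>, so
  that later only parameter tuples have to be counted, not vectors.\<close>

lemma orthonormal_family_isometry:
  fixes v :: "'i \<Rightarrow> complex vec"
  assumes fin: "finite I" and v: "\<And>i. i \<in> I \<Longrightarrow> v i \<in> carrier_vec (n + 1)"
    and on: "\<And>i j. i \<in> I \<Longrightarrow> j \<in> I \<Longrightarrow> v j \<bullet>c v i = (if i = j then 1 else 0)"
  obtains B where "isometry n (card I) B" "set (cols B) = v ` I"
    "\<And>A. A \<in> carrier_mat (n + 1) (n + 1) \<Longrightarrow>
      (\<And>i j. i \<in> I \<Longrightarrow> j \<in> I \<Longrightarrow> (A *\<^sub>v v j) \<bullet>c v i = 0) \<Longrightarrow>
      mat_adjoint B * (A * B) = 0 \<cdot>\<^sub>m 1\<^sub>m (card I)"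
proof -
  from finite_distinct_list[OF fin] obtain js where js: "set js = I" "distinct js" by blast
  define B where "B = mat_of_cols (n + 1) (map v js)"
  have len: "length js = card I" using js distinct_card by metis
  have B: "B \<in> carrier_mat (n + 1) (card I)"
    unfolding B_def len[symmetric] by (intro carrier_matI) auto
  have col: "col B i = v (js ! i)" if "i < card I" for i
    using that js(1) v len by (auto simp: B_def col_mat_of_cols)
  have inI: "js ! i \<in> I" if "i < card I" for i
    using that js(1) len by auto
  have entry: "(mat_adjoint B * (A * B)) $$ (i, j) = (A *\<^sub>v v (js ! j)) \<bullet>c v (js ! i)"
    if "A \<in> carrier_mat (n + 1) (n + 1)" "i < card I" "j < card I" for A i j
    using compression_index[OF B that] that by (simp add: col)
  have "mat_adjoint B * B = 1\<^sub>m (card I)"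
  proof (rule eq_matI)
    fix i j assume "i < dim_row (1\<^sub>m (card I) :: complex mat)" "j < dim_col (1\<^sub>m (card I) :: complex mat)"
    then have ij: "i < card I" "j < card I" by auto
    show "(mat_adjoint B * B) $$ (i, j) = 1\<^sub>m (card I) $$ (i, j)"
      using entry[OF one_carrier_mat ij] B v[OF inI[OF ij(2)]] ij js(2) len
      by (auto simp: on inI nth_eq_iff_index_eq)
  qed (use B mat_adjoint_carrier[OF B] in auto)
  then have "isometry n (card I) B" using B by unfold_locales
  moreover have "set (cols B) = v ` I"
    unfolding B_def using js(1) v by (subst cols_mat_of_cols) auto
  moreover have "mat_adjoint B * (A * B) = 0 \<cdot>\<^sub>m 1\<^sub>m (card I)"
    if A: "A \<in> carrier_mat (n + 1) (n + 1)"
      and z: "\<And>i j. i \<in> I \<Longrightarrow> j \<in> I \<Longrightarrow> (A *\<^sub>v v j) \<bullet>c v i = 0" for A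
    by (rule eq_matI) (use A B mat_adjoint_carrier[OF B] in \<open>auto simp: entry z inI simp del: index_mult_mat(1)\<close>)
  ultimately show thesis by (rule that)
qed

text \<open>\<open>su2_code\<close> is a span of blocks that are spans themselves; the orthonormal
  basis consists of the generators of the blocks.\<close>

lemma vspan_Union_vspan:
  assumes "\<And>k. k \<in> K \<Longrightarrow> S k \<subseteq> carrier_vec (n + 1)" "X \<subseteq> carrier_vec (n + 1)"
  shows "vspan n ((\<Union>k\<in>K. vspan n (S k)) \<union> X) = vspan n ((\<Union>k\<in>K. S k) \<union> X)"
proof -
  interpret V: vec_space "TYPE(complex)" "n + 1" .
  let ?S = "(\<Union>k\<in>K. S k) \<union> X" and ?T = "(\<Union>k\<in>K. vspan n (S k)) \<union> X"
  have S: "?S \<subseteq> carrier_vec (n + 1)" using assms by blast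
  have "vspan n (S k) \<subseteq> vspan n ?S" if "k \<in> K" for k
    using that by (intro V.span_is_monotone) blast
  moreover have "X \<subseteq> vspan n ?S" using V.in_own_span[of ?S] S by auto
  ultimately have T: "?T \<subseteq> vspan n ?S" by blast
  have "S k \<subseteq> vspan n (S k)" if "k \<in> K" for k
    using V.in_own_span[of "S k"] assms(1)[OF that] by auto
  then have "?S \<subseteq> ?T" by blast
  then have "vspan n ?S \<subseteq> vspan n ?T" by (rule V.span_is_monotone)
  moreover have "vspan n ?T \<subseteq> vspan n ?S" by (rule V.span_subsetI[OF S T])
  ultimately show ?thesis by blast
qed

lemma quantum_code_vspan:
  assumes "S \<subseteq> carrier_vec (n + 1)"
  shows "quantum_code n (vspan n S)"
proof -
  interpret V: vec_space "TYPE(complex)" "n + 1" .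
  show ?thesis
    unfolding quantum_code_def using V.span_is_subspace[of S] assms by simp
qed

section \<open>Operators shifting the weight\<close>

text \<open>No case distinction at the extreme weights is needed, since \<open>ket\<close> vanishes beyond them.\<close>

definition ladder :: "nat \<Rightarrow> int \<Rightarrow> (int \<Rightarrow> real) \<Rightarrow> complex mat"
  where "ladder n s g = op_on_kets n (\<lambda>k. complex_of_real (g k) \<cdot>\<^sub>v ket n (k + s))"

definition raising_coeff :: "nat \<Rightarrow> int \<Rightarrow> real"
  where "raising_coeff n k = sqrt (real_of_int ((int n - k) * (int n + k + 2)) / 4)"

abbreviation weights :: "nat \<Rightarrow> int set"
  where "weights n \<equiv> weight n ` {..n}"

lemma mem_weights_iff: "k \<in> weights n \<longleftrightarrow> \<bar>k\<bar> \<le> int n \<and> even (k - int n)"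
proof
  assume R: "\<bar>k\<bar> \<le> int n \<and> even (k - int n)"
  then have "even (k + int n)" by presburger
  then obtain j where j: "k + int n = 2 * j" by (elim evenE)
  with R have "k = weight n (nat j)" "nat j \<le> n" by (auto simp: weight_def)
  then show "k \<in> weights n" by blast
qed (auto simp: weight_def)

lemma ket_carrier [simp]: "ket n k \<in> carrier_vec (n + 1)"
  by (simp add: ket_def)

lemma ket_eq_zero: "k \<notin> weights n \<Longrightarrow> ket n k = 0\<^sub>v (n + 1)"
  by (intro eq_vecI) (auto simp: ket_def)

lemma zero_smult_ket [simp]: "0 \<cdot>\<^sub>v ket n k = 0\<^sub>v (n + 1)"
  by (intro eq_vecI) (auto simp: ket_def)

lemma op_on_kets_carrier [simp]: "op_on_kets n f \<in> carrier_mat (n + 1) (n + 1)"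
  by (simp add: op_on_kets_def carrier_matI)

lemma ladder_carrier [simp]: "ladder n s g \<in> carrier_mat (n + 1) (n + 1)"
  by (simp add: ladder_def)

lemma dim_ladder [simp]: "dim_row (ladder n s g) = n + 1" "dim_col (ladder n s g) = n + 1"
  using carrier_matD[OF ladder_carrier] by blast+

lemma op_on_kets_cong:
  assumes "\<And>k. k \<in> weights n \<Longrightarrow> f k = g k"
  shows "op_on_kets n f = op_on_kets n g"
proof -
  have "map (\<lambda>i. f (weight n i)) [0..<n + 1] = map (\<lambda>i. g (weight n i)) [0..<n + 1]"
    using assms by (intro map_cong) auto
  then show ?thesis unfolding op_on_kets_def by (simp only:)
qed

lemma ladder_ket:
  "k \<in> weights n \<Longrightarrow> ladder n s g *\<^sub>v ket n k = complex_of_real (g k) \<cdot>\<^sub>v ket n (k + s)"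
  unfolding ladder_def by (auto simp: op_on_kets_ket)

lemma ket_eq_unit_vec: "ket n (weight n i) = unit_vec (n + 1) i"
  by (auto simp: ket_def weight_def unit_vec_def)

text \<open>A shift may push \<open>l\<close> out of the weight range; then \<open>ket n l\<close>
  is zero and \<open>l = k\<close> fails, so the formula persists.\<close>

lemma ket_sprod:
  assumes "k \<in> weights n"
  shows "ket n l \<bullet>c ket n k = (if l = k then 1 else 0)"
proof -
  from assms obtain i where i: "i \<le> n" "k = weight n i" by auto
  have "ket n k = unit_vec (n + 1) i"
    by (simp add: i ket_eq_unit_vec)
  moreover have "conjugate (unit_vec (n + 1) i) = (unit_vec (n + 1) i :: complex vec)"
    by (intro eq_vecI) (auto simp: unit_vec_def)
  ultimately show ?thesis
    using i by (auto simp: ket_def)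
qed

lemma one_eq_ladder: "1\<^sub>m (n + 1) = ladder n 0 (\<lambda>_. 1)"
proof (rule eq_matI)
  fix i j assume "i < dim_row (ladder n 0 (\<lambda>_. 1))" "j < dim_col (ladder n 0 (\<lambda>_. 1))"
  then have "i < n + 1" "j < n + 1" by (simp_all add: ladder_def op_on_kets_def)
  then show "1\<^sub>m (n + 1) $$ (i, j) = ladder n 0 (\<lambda>_. 1) $$ (i, j)"
    by (auto simp: ladder_def op_on_kets_def mat_of_cols_index ket_def weight_def simp del: upt_Suc)
qed (auto simp: ladder_def op_on_kets_def)

lemma H_eq_ladder: "H_op n = ladder n 0 real_of_int"
  by (simp add: H_op_def ladder_def)

lemma E_eq_ladder: "E_op n = ladder n 2 (raising_coeff n)"
  unfolding E_op_def ladder_def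
  by (rule op_on_kets_cong) (auto simp: raising_coeff_def)

text \<open>\<open>F\<close> is adjoint to \<open>E\<close>, so its coefficient at \<open>k\<close>
  is that of \<open>E\<close> on the way up from \<open>k - 2\<close>. It vanishes at the lowest
  weight, which absorbs the exceptional case of \<open>F_op\<close>.\<close>

lemma F_eq_ladder: "F_op n = ladder n (- 2) (\<lambda>k. raising_coeff n (k - 2))"
  unfolding F_op_def ladder_def
  by (rule op_on_kets_cong) (auto simp: raising_coeff_def algebra_simps)

lemma mat_eq_ketI:
  assumes A: "A \<in> carrier_mat (n + 1) (n + 1)" and B: "B \<in> carrier_mat (n + 1) (n + 1)"
    and eq: "\<And>k. k \<in> weights n \<Longrightarrow> A *\<^sub>v ket n k = B *\<^sub>v ket n k"
  shows "A = B"
proof (rule eq_matI)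
  fix i j assume "i < dim_row B" "j < dim_col B"
  then have ij: "i < n + 1" "j < n + 1" using B by auto
  have entry: "M $$ (i, j) = (M *\<^sub>v ket n (weight n j)) $ i" if "M \<in> carrier_mat (n + 1) (n + 1)" for M
    using that ij scalar_prod_right_unit[of j "n + 1" "row M i"] by (simp add: ket_eq_unit_vec)
  show "A $$ (i, j) = B $$ (i, j)"
    unfolding entry[OF A] entry[OF B] using ij by (subst eq) auto
qed (use A B in auto)

lemma diagonal_mult_ladder:
  "ladder n 0 g * ladder n t h = ladder n t (\<lambda>k. g (k + t) * h k)"
proof (rule mat_eq_ketI)
  fix k assume k: "k \<in> weights n"
  have "ladder n 0 g * ladder n t h *\<^sub>v ket n k = ladder n 0 g *\<^sub>v (complex_of_real (h k) \<cdot>\<^sub>v ket n (k + t))"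
    using k by (simp add: assoc_mult_mat_vec[OF ladder_carrier ladder_carrier ket_carrier] ladder_ket)
  also have "\<dots> = complex_of_real (h k) \<cdot>\<^sub>v (ladder n 0 g *\<^sub>v ket n (k + t))"
    by (rule mult_mat_vec[OF ladder_carrier ket_carrier])
  also have "\<dots> = complex_of_real (g (k + t) * h k) \<cdot>\<^sub>v ket n (k + t)"
  \<comment> \<open>\<open>ladder_ket\<close> speaks of weights only; when the shift leaves their
    range, both sides are zero.\<close>
  proof (cases "k + t \<in> weights n")
    case True
    then show ?thesis by (simp add: ladder_ket smult_smult_assoc mult.commute)
  next
    case False
    have "ladder n 0 g *\<^sub>v 0\<^sub>v (n + 1) = 0\<^sub>v (n + 1)"
      by (intro eq_vecI) (auto simp: scalar_prod_def)
    moreover have "c \<cdot>\<^sub>v 0\<^sub>v (n + 1) = 0\<^sub>v (n + 1)" for c :: complex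
      by (intro eq_vecI) auto
    ultimately show ?thesis using False by (simp add: ket_eq_zero)
  qed
  also have "\<dots> = ladder n t (\<lambda>k. g (k + t) * h k) *\<^sub>v ket n k"
    using k by (simp add: ladder_ket)
  finally show "ladder n 0 g * ladder n t h *\<^sub>v ket n k = \<dots>" .
qed (rule mult_carrier_mat[OF ladder_carrier ladder_carrier] ladder_carrier)+

section \<open>Vectors supported on two kets and their matrix elements\<close>

type_synonym two_ket = "real \<times> int \<times> real \<times> int"

fun two_kets :: "nat \<Rightarrow> two_ket \<Rightarrow> complex vec"
  where "two_kets n (a, k, b, l) = complex_of_real a \<cdot>\<^sub>v ket n k + complex_of_real b \<cdot>\<^sub>v ket n l"

fun in_weights :: "nat \<Rightarrow> two_ket \<Rightarrow> bool"
  where "in_weights n (a, k, b, l) \<longleftrightarrow> k \<in> weights n \<and> l \<in> weights n"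

text \<open>This is \<open><x| L |y>\<close> for the ladder operator with shift \<open>s\<close>,
  expanded over pairs of kets; the first tuple is the bra. No conjugation appears because amplitudes
  are real.\<close>

fun matrix_element :: "int \<Rightarrow> (int \<Rightarrow> real) \<Rightarrow> two_ket \<Rightarrow> two_ket \<Rightarrow> real"
  where "matrix_element s g (a, k, b, l) (a', k', b', l') =
    a * a' * (if k = k' + s then g k' else 0) + a * b' * (if k = l' + s then g l' else 0) +
    b * a' * (if l = k' + s then g k' else 0) + b * b' * (if l = l' + s then g l' else 0)"

lemma two_kets_carrier [simp]: "two_kets n x \<in> carrier_vec (n + 1)"
  by (cases x) simp

lemma ladder_two_kets:
  assumes "in_weights n y"
  shows "ladder n s g *\<^sub>v two_kets n y =
    (case y of (a, k, b, l) \<Rightarrow> complex_of_real (a * g k) \<cdot>\<^sub>v ket n (k + s) + complex_of_real (b * g l) \<cdot>\<^sub>v ket n (l + s))"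
  using assms
  by (cases y) (simp add: mult_add_distrib_mat_vec[OF ladder_carrier] mult_mat_vec[OF ladder_carrier]
      ladder_ket smult_smult_assoc)

lemma sprod_two_kets:
  assumes "w \<in> carrier_vec (n + 1)"
  shows "w \<bullet>c two_kets n (a, k, b, l) = complex_of_real a * (w \<bullet>c ket n k) + complex_of_real b * (w \<bullet>c ket n l)"
proof -
  have "conjugate (two_kets n (a, k, b, l)) =
      complex_of_real a \<cdot>\<^sub>v conjugate (ket n k) + complex_of_real b \<cdot>\<^sub>v conjugate (ket n l)"
    by (intro eq_vecI) (auto simp: ket_def)
  then show ?thesis
    using assms by (simp add: scalar_prod_add_distrib[of _ "n + 1"])
qed

lemma matrix_element_eq:
  assumes "in_weights n x" "in_weights n y"
  shows "(ladder n s g *\<^sub>v two_kets n y) \<bullet>c two_kets n x = complex_of_real (matrix_element s g x y)"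
proof -
  obtain a k b l where x: "x = (a, k, b, l)" by (cases x)
  obtain a' k' b' l' where y: "y = (a', k', b', l')" by (cases y)
  have *: "(complex_of_real c \<cdot>\<^sub>v ket n p + complex_of_real d \<cdot>\<^sub>v ket n q) \<bullet>c ket n r =
      complex_of_real ((if p = r then c else 0) + (if q = r then d else 0))"
    if "r \<in> weights n" for c d p q r
    using that
    by (simp add: add_scalar_prod_distrib[of _ "n + 1"] smult_scalar_prod_distrib[of _ "n + 1"] ket_sprod)
  show ?thesis
    using assms unfolding ladder_two_kets[OF assms(2)]
    by (simp add: x y sprod_two_kets * del: two_kets.simps of_real_mult of_real_add)
      (simp only: of_real_mult[symmetric] of_real_add[symmetric] of_real_eq_iff, simp add: algebra_simps)
qed

lemma two_kets_sprod:
  assumes "in_weights n x" "in_weights n y"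
  shows "two_kets n y \<bullet>c two_kets n x = complex_of_real (matrix_element 0 (\<lambda>_. 1) x y)"
  using matrix_element_eq[OF assms, of 0 "\<lambda>_. 1"]
  by (simp add: one_eq_ladder[symmetric] one_mult_mat_vec[OF two_kets_carrier])

section \<open>Detection\<close>

text \<open>Any \<open>P\<close> supplied by \<open>detects\<close> is self-adjoint and fixes
  \<open>u\<close> and \<open>w\<close>, so \<open>A\<close> may be replaced by
  \<open>P * A * P\<close>. To refute detection it suffices to find orthogonal code vectors with a
  nonzero matrix element.\<close>

lemma detects_matrix_element:
  assumes det: "detects n C A" and A: "A \<in> carrier_mat (n + 1) (n + 1)"
    and uw: "u \<in> C" "w \<in> C"
  obtains c where "(A *\<^sub>v w) \<bullet>c u = c * (w \<bullet>c u)"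
proof -
  from det obtain P c where proj: "orth_projection n C P" and PAP: "P * A * P = c \<cdot>\<^sub>m P"
    unfolding detects_def by blast
  from proj have P: "P \<in> carrier_mat (n + 1) (n + 1)" and idem: "P * P = P" and adj: "mat_adjoint P = P"
    and C: "C = (\<lambda>v. P *\<^sub>v v) ` carrier_vec (n + 1)"
    unfolding orth_projection_def by blast+
  have carrier: "x \<in> carrier_vec (n + 1)" if "x \<in> C" for x
    using that mult_mat_vec_carrier[OF P] unfolding C by blast
  have fixed: "P *\<^sub>v x = x" if "x \<in> C" for x
  proof -
    from that obtain y where y: "y \<in> carrier_vec (n + 1)" "x = P *\<^sub>v y" unfolding C by blast
    then show ?thesis using assoc_mult_mat_vec[OF P P y(1)] idem by metis
  qed
  have Aw: "A *\<^sub>v w \<in> carrier_vec (n + 1)"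
    by (rule mult_mat_vec_carrier[OF A carrier[OF uw(2)]])
  have "(A *\<^sub>v w) \<bullet>c u = (A *\<^sub>v w) \<bullet>c (mat_adjoint P *\<^sub>v u)"
    by (simp only: adj fixed[OF uw(1)])
  also have "\<dots> = (P *\<^sub>v (A *\<^sub>v w)) \<bullet>c u"
    by (rule mat_adjoint_scalar_prod[OF P Aw carrier[OF uw(1)], symmetric])
  also have "P *\<^sub>v (A *\<^sub>v w) = P * A *\<^sub>v (P *\<^sub>v w)"
    by (simp only: fixed[OF uw(2)] assoc_mult_mat_vec[OF P A carrier[OF uw(2)]])
  also have "\<dots> = (c \<cdot>\<^sub>m P) *\<^sub>v w"
    by (simp only: assoc_mult_mat_vec[OF mult_carrier_mat[OF P A] P carrier[OF uw(2)], symmetric] PAP)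
  also have "\<dots> = c \<cdot>\<^sub>v (P *\<^sub>v w)"
    using P carrier[OF uw(2)] by (intro eq_vecI) auto
  also have "\<dots> = c \<cdot>\<^sub>v w"
    by (simp only: fixed[OF uw(2)])
  also have "\<dots> \<bullet>c u = c * (w \<bullet>c u)"
    using carrier[OF uw(1)] carrier[OF uw(2)] by simp
  finally show thesis by (rule that)
qed

section \<open>Membership in the quantum metric\<close>

lemma opspan_subset:
  assumes "submodule class_ring D (ops n)" "S \<subseteq> D"
  shows "opspan n S \<subseteq> D"
proof -
  interpret M: matrix_vs "n + 1" "n + 1" "TYPE(complex)" .
  show ?thesis by (rule M.span_is_subset[OF assms(2,1)])
qed

lemma subset_opspan:
  assumes "S \<subseteq> carrier_mat (n + 1) (n + 1)"
  shows "S \<subseteq> opspan n S"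
proof -
  interpret M: matrix_vs "n + 1" "n + 1" "TYPE(complex)" .
  show ?thesis by (rule M.in_own_span[OF assms])
qed

lemma generators_carrier: "{1\<^sub>m (n + 1), E_op n, F_op n, H_op n} \<subseteq> carrier_mat (n + 1) (n + 1)"
  unfolding E_eq_ladder F_eq_ladder H_eq_ladder
  by (intro insert_subsetI ladder_carrier one_carrier_mat empty_subsetI)

lemma qm_gen_carrier: "qm_gen n \<subseteq> carrier_mat (n + 1) (n + 1)"
proof -
  interpret M: matrix_vs "n + 1" "n + 1" "TYPE(complex)" .
  show ?thesis unfolding qm_gen_def by (rule M.span_is_subset2[OF generators_carrier])
qed

lemma generators_in_qm_gen: "{1\<^sub>m (n + 1), E_op n, F_op n, H_op n} \<subseteq> qm_gen n"
  unfolding qm_gen_def by (rule subset_opspan[OF generators_carrier])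

text \<open>For \<open>t = 1\<close> the products have a single factor, so a linear condition on the
  metric need only be checked on the four generators.\<close>

lemma quantum_metric_one_subset:
  assumes D: "submodule class_ring D (ops n)" and gens: "{1\<^sub>m (n + 1), E_op n, F_op n, H_op n} \<subseteq> D"
  shows "quantum_metric n 1 \<subseteq> D"
proof -
  have gen: "qm_gen n \<subseteq> D" unfolding qm_gen_def by (rule opspan_subset[OF D gens])
  have "foldr (*) As (1\<^sub>m (n + 1)) \<in> D" if "length As = 1" "set As \<subseteq> qm_gen n" for As
  proof -
    from that obtain A where A: "As = [A]" "A \<in> qm_gen n"
      by (cases As) (auto simp: One_nat_def)
    have "A * 1\<^sub>m (n + 1) = A"
      by (rule right_mult_one_mat[OF subsetD[OF qm_gen_carrier A(2)]])
    then show ?thesis using gen A by auto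
  qed
  then have "opspan n {foldr (*) As (1\<^sub>m (n + 1)) | As. length As = 1 \<and> set As \<subseteq> qm_gen n} \<subseteq> D"
    by (intro opspan_subset[OF D]) blast
  then show ?thesis by (simp add: quantum_metric_def One_nat_def)
qed

lemma foldr_mult_carrier:
  "set As \<subseteq> carrier_mat N N \<Longrightarrow> foldr (*) As (1\<^sub>m N) \<in> carrier_mat N N"
  by (induction As) auto

lemma HE_in_quantum_metric:
  assumes "2 \<le> d"
  shows "H_op n * E_op n \<in> quantum_metric n (real d)"
proof -
  let ?S = "{foldr (*) As (1\<^sub>m (n + 1)) | As. length As = d \<and> set As \<subseteq> qm_gen n}"
  \<comment> \<open>The identity belongs to \<open>qm_gen\<close>, so padding with it makes
    \<open>HE\<close> a product of every length from 2 on: one operator excludes all larger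
    distances.\<close>
  define As where "As = H_op n # E_op n # replicate (d - 2) (1\<^sub>m (n + 1))"
  have "foldr (*) (replicate k (1\<^sub>m (n + 1))) (1\<^sub>m (n + 1)) = (1\<^sub>m (n + 1) :: complex mat)" for k
    by (induction k) auto
  moreover have "E_op n * 1\<^sub>m (n + 1) = E_op n"
    unfolding E_eq_ladder by (rule right_mult_one_mat[OF ladder_carrier])
  ultimately have "H_op n * E_op n = foldr (*) As (1\<^sub>m (n + 1))"
    by (simp add: As_def)
  moreover have "length As = d" "set As \<subseteq> qm_gen n"
    using assms generators_in_qm_gen by (auto simp: As_def)
  ultimately have "H_op n * E_op n \<in> ?S" by blast
  moreover have "?S \<subseteq> carrier_mat (n + 1) (n + 1)"
    using foldr_mult_carrier qm_gen_carrier by blast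
  ultimately have "H_op n * E_op n \<in> opspan n ?S"
    using subset_opspan by blast
  then show ?thesis using assms by (simp add: quantum_metric_def)
qed

text \<open>Compression is linear in \<open>A\<close>, and these operators are the preimage of the
  line of scalar matrices. This carries detection from the generators to their span.\<close>

lemma (in isometry) submodule_scalar_compressions:
  "submodule class_ring {A \<in> carrier_mat (n + 1) (n + 1). \<exists>c. mat_adjoint B * (A * B) = c \<cdot>\<^sub>m 1\<^sub>m m} (ops n)"
    (is "submodule _ ?D _")
proof -
  interpret M: matrix_vs "n + 1" "n + 1" "TYPE(complex)" .
  show ?thesis
  proof (rule submodule.intro)
    show "Module.module class_ring (ops n)" by (rule M.module_axioms)
    show "?D \<subseteq> carrier (ops n)" by (auto simp: module_mat_simps)
  next
    fix v w assume v: "v \<in> ?D" and w: "w \<in> ?D"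
    then obtain a b where ab: "mat_adjoint B * (v * B) = a \<cdot>\<^sub>m 1\<^sub>m m" "mat_adjoint B * (w * B) = b \<cdot>\<^sub>m 1\<^sub>m m"
      by auto
    from v w have c: "v * B \<in> carrier_mat (n + 1) m" "w * B \<in> carrier_mat (n + 1) m"
      using B by auto
    have "mat_adjoint B * ((v + w) * B) = mat_adjoint B * (v * B) + mat_adjoint B * (w * B)"
      using v w add_mult_distrib_mat[OF _ _ B, of v "n + 1" w] mult_add_distrib_mat[OF adj c] by simp
    also have "\<dots> = (a + b) \<cdot>\<^sub>m 1\<^sub>m m"
      unfolding ab by (intro eq_matI) auto
    finally show "v \<oplus>\<^bsub>ops n\<^esub> w \<in> ?D" using v w by (auto simp: module_mat_simps)
  next
    have "mat_adjoint B * (0\<^sub>m (n + 1) (n + 1) * B) = 0 \<cdot>\<^sub>m 1\<^sub>m m"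
      using B adj by (intro eq_matI) auto
    then show "\<zero>\<^bsub>ops n\<^esub> \<in> ?D" by (auto simp: module_mat_simps)
  next
    fix c :: complex and v assume v: "v \<in> ?D"
    then obtain a where a: "mat_adjoint B * (v * B) = a \<cdot>\<^sub>m 1\<^sub>m m" by auto
    have "mat_adjoint B * (c \<cdot>\<^sub>m v * B) = c \<cdot>\<^sub>m (mat_adjoint B * (v * B))"
      using v mult_smult_assoc_mat[OF _ B, of v "n + 1" c] mult_smult_distrib[OF adj, of "v * B" m c] B
      by auto
    also have "\<dots> = (c * a) \<cdot>\<^sub>m 1\<^sub>m m"
      by (intro eq_matI) (auto simp: a)
    finally show "c \<odot>\<^bsub>ops n\<^esub> v \<in> ?D" using v by (auto simp: module_mat_simps)
  qed
qed

lemma (in isometry) detects_quantum_metric_one: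
  assumes "\<And>A. A \<in> {E_op n, F_op n, H_op n} \<Longrightarrow> mat_adjoint B * (A * B) = 0 \<cdot>\<^sub>m 1\<^sub>m m"
    and A: "A \<in> quantum_metric n 1"
  shows "detects n (vspan n (set (cols B))) A"
proof -
  \<comment> \<open>The identity compresses to the Gram matrix, hence to the scalar 1 and not
    0.\<close>
  have "mat_adjoint B * (1\<^sub>m (n + 1) * B) = 1 \<cdot>\<^sub>m 1\<^sub>m m"
    using gram left_mult_one_mat[OF B] by (auto intro!: eq_matI)
  then have "{1\<^sub>m (n + 1), E_op n, F_op n, H_op n} \<subseteq>
      {A \<in> carrier_mat (n + 1) (n + 1). \<exists>c. mat_adjoint B * (A * B) = c \<cdot>\<^sub>m 1\<^sub>m m}"
    using assms(1) generators_carrier[of n] by blast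
  from quantum_metric_one_subset[OF submodule_scalar_compressions this] A detectsI
  show ?thesis by blast
qed

section \<open>The code\<close>

definition psi1_params :: "int \<Rightarrow> two_ket"
  where "psi1_params k = (sqrt (real_of_int k / real_of_int (2 * k - 2)), 2 - k,
    - sqrt (real_of_int (k - 2) / real_of_int (2 * k - 2)), k)"

definition psi2_params :: "int \<Rightarrow> two_ket"
  where "psi2_params k = (sqrt (real_of_int (k - 2) / real_of_int (2 * k - 2)), - k,
    sqrt (real_of_int k / real_of_int (2 * k - 2)), k - 2)"

text \<open>Comparing the two weight slots would give both \<open>k' = k - 2\<close> and
  \<open>k' = k + 2\<close>.\<close>

lemma psi1_params_neq_psi2_params: "psi1_params k \<noteq> psi2_params k'"
proof
  assume "psi1_params k = psi2_params k'"
  then have "2 - k = - k'" "k = k' - 2"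
    unfolding psi1_params_def psi2_params_def prod.inject by blast+
  then show False by linarith
qed

lemma psi1_eq: "psi1 n k = two_kets n (psi1_params k)"
  by (intro eq_vecI) (auto simp: psi1_def psi1_params_def ket_def)

lemma psi2_eq: "psi2 n k = two_kets n (psi2_params k)"
  by (intro eq_vecI) (auto simp: psi2_def psi2_params_def ket_def)

text \<open>The clauses belong to the identity, \<open>H\<close>, \<open>E\<close> and
  \<open>F\<close> in this order: orthonormality, then zero compression of the other
  generators.\<close>

definition unmixed :: "nat \<Rightarrow> two_ket \<Rightarrow> two_ket \<Rightarrow> bool"
  where "unmixed n x y \<longleftrightarrow>
    matrix_element 0 (\<lambda>_. 1) x y = (if x = y then 1 else 0) \<and>
    matrix_element 0 real_of_int x y = 0 \<and>
    matrix_element 2 (raising_coeff n) x y = 0 \<and>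
    matrix_element (- 2) (\<lambda>k. raising_coeff n (k - 2)) x y = 0"

fun far_apart :: "two_ket \<Rightarrow> two_ket \<Rightarrow> bool"
  where "far_apart (a, k, b, l) (a', k', b', l') \<longleftrightarrow>
    \<bar>k - k'\<bar> > 2 \<and> \<bar>k - l'\<bar> > 2 \<and> \<bar>l - k'\<bar> > 2 \<and> \<bar>l - l'\<bar> > 2"

lemma far_apart_matrix_element:
  "far_apart x y \<Longrightarrow> \<bar>s\<bar> \<le> 2 \<Longrightarrow> matrix_element s g x y = 0"
  by (cases x; cases y) auto

text \<open>Every generator shifts weights by at most 2, and tuples that are far apart cannot be
  equal, so all four values are 0.\<close>

lemma far_apart_unmixed: "far_apart x y \<Longrightarrow> unmixed n x y"
  by (cases x; cases y) (auto simp: unmixed_def far_apart_matrix_element simp del: matrix_element.simps)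

text \<open>The two factors under the root are exchanged by \<open>k \<mapsto> - 2 - k\<close>, the
  reflection of the weight diagram.\<close>

lemma raising_coeff_reflect: "raising_coeff n (- k) = raising_coeff n (k - 2)"
  by (simp add: raising_coeff_def algebra_simps)

text \<open>The same symmetry in the shape produced by \<open>F\<close> acting at weight
  \<open>2 - k\<close>.\<close>

lemma raising_coeff_reflect': "raising_coeff n (2 - k - 2) = raising_coeff n (k - 2)"
  using raising_coeff_reflect[of n k] by (simp add: algebra_simps)

lemma block_unmixed:
  assumes k: "4 \<le> k" and xy: "x \<in> {psi1_params k, psi2_params k}" "y \<in> {psi1_params k, psi2_params k}"
  shows "unmixed n x y"
proof -
  define a b where "a = sqrt (real_of_int k / real_of_int (2 * k - 2))"
    and "b = sqrt (real_of_int (k - 2) / real_of_int (2 * k - 2))"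
  have p1: "psi1_params k = (a, 2 - k, - b, k)" and p2: "psi2_params k = (b, - k, a, k - 2)"
    by (simp_all add: psi1_params_def psi2_params_def a_def b_def)
  have sq: "a * a = real_of_int k / real_of_int (2 * k - 2)" "b * b = real_of_int (k - 2) / real_of_int (2 * k - 2)"
    using k by (simp_all add: a_def b_def)
  have norm: "a * a + b * b = 1"
    unfolding sq using k by (simp add: add_divide_distrib[symmetric])
  have H: "a * a * (2 - real_of_int k) + b * b * real_of_int k = 0"
    unfolding sq using k by (simp add: field_simps)
  have "unmixed n (psi1_params k) (psi1_params k)"
    using k norm H by (auto simp: unmixed_def p1 algebra_simps)
  moreover have "unmixed n (psi2_params k) (psi2_params k)"
    using k norm H by (auto simp: unmixed_def p2 algebra_simps)
  \<comment> \<open>\<open>E\<close> carries \<open>- k\<close> to \<open>2 - k\<close> with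
    amplitude product \<open>a * b\<close> and \<open>k - 2\<close> to \<open>k\<close> with
    \<open>- a * b\<close>; the reflection equates the coefficients. The next case is the adjoint
    one for \<open>F\<close>.\<close>
  moreover have "unmixed n (psi1_params k) (psi2_params k)"
    using k raising_coeff_reflect[of n k] by (auto simp: unmixed_def p1 p2)
  moreover have "unmixed n (psi2_params k) (psi1_params k)"
    using k raising_coeff_reflect'[of n k] by (auto simp: unmixed_def p1 p2)
  ultimately show ?thesis using xy by blast
qed

fun supported_below :: "int \<Rightarrow> two_ket \<Rightarrow> bool"
  where "supported_below r (a, k, b, l) \<longleftrightarrow> \<bar>k\<bar> < r \<and> \<bar>l\<bar> < r"

text \<open>The absolute weights are at most \<open>k\<close> in one block and at least
  \<open>k' - 2\<close>, hence at least \<open>k + 4\<close>, in the other.\<close>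

lemma block_far_apart:
  assumes "4 \<le> k" "k + 6 \<le> k'" "x \<in> {psi1_params k, psi2_params k}" "y \<in> {psi1_params k', psi2_params k'}"
  shows "far_apart x y" "far_apart y x"
  using assms by (auto simp: psi1_params_def psi2_params_def)

text \<open>The smallest absolute weight in the block at \<open>k\<close> is \<open>k - 2\<close>,
  so the strict bound \<open>k - 4\<close> leaves a gap above 2.\<close>

lemma supported_below_far_apart:
  assumes "supported_below (k - 4) x" "y \<in> {psi1_params k, psi2_params k}"
  shows "far_apart x y" "far_apart y x"
  using assms by (cases x; auto simp: psi1_params_def psi2_params_def)+

text \<open>Here \<open>m\<close> is the index of the lowest block, \<open>N\<close> the number of
  blocks and \<open>X\<close> the set of extra vectors near weight 0. The equation says that the top
  block has index \<open>n\<close>, without subtracting.\<close>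

locale block_code =
  fixes n N :: nat and m :: int and X :: "two_ket set"
  assumes m: "4 \<le> m" and N: "1 \<le> N" "int n + 6 = m + 6 * int N" and X: "finite X"
    and X_weights: "\<And>x. x \<in> X \<Longrightarrow> in_weights n x"
    and X_below: "\<And>x. x \<in> X \<Longrightarrow> supported_below (m - 4) x"
    and X_unmixed: "\<And>x y. x \<in> X \<Longrightarrow> y \<in> X \<Longrightarrow> unmixed n x y"
begin

definition K :: "int set"
  where "K = {k. m \<le> k \<and> k \<le> int n \<and> k mod 6 = int n mod 6}"

definition I :: "two_ket set"
  where "I = (\<Union>k\<in>K. {psi1_params k, psi2_params k}) \<union> X"

definition C :: "complex vec set"
  where "C = vspan n (blocks_down_to n m \<union> two_kets n ` X)"

lemma n_eq: "int n = m + 6 * (int N - 1)"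
  using N(2) by simp

lemma K_eq: "K = (\<lambda>t. m + 6 * int t) ` {..<N}"
proof (intro equalityI subsetI)
  fix k assume k: "k \<in> K"
  then have "6 dvd int n - k" by (simp add: K_def mod_eq_dvd_iff[symmetric])
  then obtain c where c: "int n - k = 6 * c" by (elim dvdE)
  have "m \<le> k" "k \<le> int n" using k by (simp_all add: K_def)
  \<comment> \<open>The value \<open>c\<close> counts blocks down from the top, while the
    parametrisation counts up from \<open>m\<close>.\<close>
  with c N have "k = m + 6 * int (nat (int N - 1 - c))" "nat (int N - 1 - c) < N" by linarith+
  then show "k \<in> (\<lambda>t. m + 6 * int t) ` {..<N}" by blast
next
  fix k assume "k \<in> (\<lambda>t. m + 6 * int t) ` {..<N}"
  then obtain t where t: "k = m + 6 * int t" "t < N" by blast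
  have "int n - k = 6 * (int N - 1 - int t)" by (simp add: t n_eq)
  then have "k mod 6 = int n mod 6" by (metis dvd_triv_left mod_eq_dvd_iff)
  moreover have "m \<le> k" "k \<le> int n" using t N by linarith+
  ultimately show "k \<in> K" by (simp add: K_def)
qed

lemma K_bounds: "k \<in> K \<Longrightarrow> 4 \<le> k" "k \<in> K \<Longrightarrow> k \<le> int n"
  using m by (auto simp: K_def)

lemma K_parity:
  assumes "k \<in> K"
  shows "even (k - int n)"
proof -
  from assms obtain t where t: "k = m + 6 * int t" by (auto simp: K_eq)
  have "k - int n = 2 * (3 * (int t + 1 - int N))" by (simp add: t n_eq)
  then show ?thesis by simp
qed

lemma K_spaced: "k \<in> K \<Longrightarrow> k' \<in> K \<Longrightarrow> k < k' \<Longrightarrow> k + 6 \<le> k'"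
  unfolding K_eq by auto

lemma n_in_K: "int n \<in> K"
  using N by (simp add: K_def)

text \<open>A tuple of a block contains a weight of absolute value at least \<open>m\<close>, which
  separates it from \<open>X\<close>; the \<open>psi1\<close> and \<open>psi2\<close> tuples never
  coincide.\<close>

lemma card_I: "finite I" "card I = 2 * N + card X"
proof -
  have finK: "finite K" and cardK: "card K = N"
    by (auto simp: K_eq card_image inj_on_def)
  have I: "I = psi1_params ` K \<union> psi2_params ` K \<union> X"
    by (auto simp: I_def)
  have "inj_on psi1_params K" "inj_on psi2_params K"
    by (rule inj_onI, simp only: psi1_params_def psi2_params_def prod.inject neg_equal_iff_equal)+
  then have "card (psi1_params ` K) = N" "card (psi2_params ` K) = N"
    by (simp_all add: card_image cardK)
  moreover have "psi1_params ` K \<inter> psi2_params ` K = {}"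
    using psi1_params_neq_psi2_params by blast
  moreover have "(psi1_params ` K \<union> psi2_params ` K) \<inter> X = {}"
  proof -
    have "\<not> supported_below (m - 4) (psi1_params k)" "\<not> supported_below (m - 4) (psi2_params k)"
      if "k \<in> K" for k
      using that m by (simp_all add: psi1_params_def psi2_params_def K_def)
    then show ?thesis using X_below by blast
  qed
  ultimately show "finite I" "card I = 2 * N + card X"
    unfolding I using finK X by (simp_all add: card_Un_disjoint)
qed

lemma I_weights:
  assumes "x \<in> I"
  shows "in_weights n x"
proof (cases "x \<in> X")
  case False
  with assms obtain k where k: "k \<in> K" "x \<in> {psi1_params k, psi2_params k}" by (auto simp: I_def)
  have bounds: "4 \<le> k" "k \<le> int n" "even k = even n"
    using K_bounds[OF k(1)] K_parity[OF k(1)] by simp_all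
  then have "k \<in> weights n" "- k \<in> weights n" "k - 2 \<in> weights n" "2 - k \<in> weights n"
    unfolding mem_weights_iff by simp_all
  with k(2) show ?thesis
    unfolding psi1_params_def psi2_params_def insert_iff empty_iff
    by (elim disjE) (simp_all only: in_weights.simps)
qed (rule X_weights)

lemma I_unmixed:
  assumes "x \<in> I" "y \<in> I"
  shows "unmixed n x y"
proof -
  have block_X: "unmixed n x y" "unmixed n y x"
    if "k \<in> K" "y \<in> {psi1_params k, psi2_params k}" "x \<in> X" for k x y
  proof -
    have "m \<le> k" using that(1) by (simp add: K_def)
    then have "supported_below (k - 4) x"
      using X_below[OF that(3)] by (cases x) simp
    from supported_below_far_apart[OF this that(2)]
    show "unmixed n x y" "unmixed n y x" by (simp_all only: far_apart_unmixed)
  qed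
  have block_block: "unmixed n x y"
    if k: "k \<in> K" "x \<in> {psi1_params k, psi2_params k}" and k': "k' \<in> K" "y \<in> {psi1_params k', psi2_params k'}"
    for k k' x y
  proof (cases k k' rule: linorder_cases)
    case less
    show ?thesis
      by (rule far_apart_unmixed[OF block_far_apart(1)[OF K_bounds(1)[OF k(1)] K_spaced[OF k(1) k'(1) less] k(2) k'(2)]])
  next
    case equal
    show ?thesis
      by (rule block_unmixed[OF K_bounds(1)[OF k(1)] k(2) k'(2)[folded equal]])
  next
    case greater
    show ?thesis
      by (rule far_apart_unmixed[OF block_far_apart(2)[OF K_bounds(1)[OF k'(1)] K_spaced[OF k'(1) k(1) greater] k'(2) k(2)]])
  qed
  from assms show ?thesis
    unfolding I_def by (elim UnE UN_E) (rule block_block block_X X_unmixed; assumption)+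
qed

lemma C_eq: "C = vspan n (two_kets n ` I)"
proof -
  have "C = vspan n ((\<Union>k\<in>K. vspan n {psi1 n k, psi2 n k}) \<union> two_kets n ` X)"
    by (simp add: C_def blocks_down_to_def block_def K_def)
  also have "\<dots> = vspan n ((\<Union>k\<in>K. {psi1 n k, psi2 n k}) \<union> two_kets n ` X)"
    by (rule vspan_Union_vspan) (auto simp: psi1_eq psi2_eq intro: two_kets_carrier)
  also have "(\<Union>k\<in>K. {psi1 n k, psi2 n k}) \<union> two_kets n ` X = two_kets n ` I"
    by (auto simp: I_def psi1_eq psi2_eq)
  finally show ?thesis .
qed

lemma quantum_code_C: "quantum_code n C"
  unfolding C_eq by (rule quantum_code_vspan) (auto intro: two_kets_carrier)

lemma dim_and_detection:
  "subdim n C = 2 * N + card X" "A \<in> quantum_metric n 1 \<Longrightarrow> detects n C A"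
proof -
  have on: "two_kets n y \<bullet>c two_kets n x = (if x = y then 1 else 0)" if "x \<in> I" "y \<in> I" for x y
    using I_unmixed[OF that] two_kets_sprod[OF that[THEN I_weights]] by (auto simp: unmixed_def)
  obtain B where B: "isometry n (card I) B" and cols: "set (cols B) = two_kets n ` I"
    and compress: "\<And>A. A \<in> carrier_mat (n + 1) (n + 1) \<Longrightarrow>
      (\<And>x y. x \<in> I \<Longrightarrow> y \<in> I \<Longrightarrow> (A *\<^sub>v two_kets n y) \<bullet>c two_kets n x = 0) \<Longrightarrow>
      mat_adjoint B * (A * B) = 0 \<cdot>\<^sub>m 1\<^sub>m (card I)"
    using orthonormal_family_isometry[OF card_I(1) two_kets_carrier on] by blast
  interpret isometry n "card I" B by (rule B)
  show "subdim n C = 2 * N + card X"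
    using dim_range by (simp add: C_eq cols card_I)
  have zero: "mat_adjoint B * (ladder n s g * B) = 0 \<cdot>\<^sub>m 1\<^sub>m (card I)"
    if "\<And>x y. unmixed n x y \<Longrightarrow> matrix_element s g x y = 0" for s g
  proof (rule compress[OF ladder_carrier])
    fix x y assume xy: "x \<in> I" "y \<in> I"
    show "(ladder n s g *\<^sub>v two_kets n y) \<bullet>c two_kets n x = 0"
      unfolding matrix_element_eq[OF xy[THEN I_weights]] that[OF I_unmixed[OF xy]] by simp
  qed
  have "mat_adjoint B * (A * B) = 0 \<cdot>\<^sub>m 1\<^sub>m (card I)" if "A \<in> {E_op n, F_op n, H_op n}" for A
    using that zero[of 2 "raising_coeff n"] zero[of 0 real_of_int]
      zero[of "- 2" "\<lambda>k. raising_coeff n (k - 2)"]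
    by (auto simp: E_eq_ladder F_eq_ladder H_eq_ladder unmixed_def)
  then show "detects n C A" if "A \<in> quantum_metric n 1"
    unfolding C_eq cols[symmetric] using detects_quantum_metric_one that by blast
qed

text \<open>The top block is present in every residue class, and there the coefficient at the lowest
  weight is simply \<open>sqrt (real n)\<close>.\<close>

lemma not_detects_HE: "\<not> detects n C (H_op n * E_op n)"
proof
  assume det: "detects n C (H_op n * E_op n)"
  let ?x = "psi1_params (int n)" and ?y = "psi2_params (int n)"
  let ?g = "\<lambda>k. real_of_int (k + 2) * raising_coeff n k"
  have n4: "4 \<le> int n" by (rule K_bounds(1)[OF n_in_K])
  have I: "?x \<in> I" "?y \<in> I" using n_in_K by (auto simp: I_def)
  interpret V: vec_space "TYPE(complex)" "n + 1" .
  have "two_kets n ` I \<subseteq> C"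
    unfolding C_eq by (rule V.in_own_span) (auto simp: two_kets_carrier)
  with I have inC: "two_kets n ?x \<in> C" "two_kets n ?y \<in> C" by auto
  have HE: "H_op n * E_op n = ladder n 2 ?g"
    by (simp add: H_eq_ladder E_eq_ladder diagonal_mult_ladder)
  obtain c where "(ladder n 2 ?g *\<^sub>v two_kets n ?y) \<bullet>c two_kets n ?x = c * (two_kets n ?y \<bullet>c two_kets n ?x)"
    using detects_matrix_element[OF det[unfolded HE] ladder_carrier inC] by blast
  moreover have "?x \<noteq> ?y" by (rule psi1_params_neq_psi2_params)
  ultimately have zero: "matrix_element 2 ?g ?x ?y = 0"
    using I_unmixed[OF I]
    by (simp add: matrix_element_eq[OF I[THEN I_weights]] two_kets_sprod[OF I[THEN I_weights]] unmixed_def)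
  define a b where "a = sqrt (real_of_int (int n) / real_of_int (2 * int n - 2))"
    and "b = sqrt (real_of_int (int n - 2) / real_of_int (2 * int n - 2))"
  have rc: "raising_coeff n (- int n) = sqrt (real n)"
    by (simp add: raising_coeff_def)
  have params: "?x = (a, 2 - int n, - b, int n)" "?y = (b, - int n, a, int n - 2)"
    by (simp_all only: psi1_params_def psi2_params_def a_def b_def)
  \<comment> \<open>The factor \<open>k + 2\<close> in \<open>?g\<close> is the weight reached by
    \<open>E\<close>: it is \<open>2 - n\<close> for the first term and \<open>n\<close> for the
    second, whose difference \<open>2 - 2 * n\<close> is nonzero.\<close>
  have "matrix_element 2 ?g ?x ?y = a * b * ?g (- int n) - b * a * ?g (int n - 2)"
    using n4 unfolding params by simp
  also have "\<dots> = a * b * (2 - 2 * real n) * sqrt (real n)"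
    unfolding raising_coeff_reflect[of n "int n", symmetric] rc by (simp add: algebra_simps)
  finally have "a * b * (2 - 2 * real n) * sqrt (real n) = 0"
    unfolding zero by (rule sym)
  moreover have "a \<noteq> 0" "b \<noteq> 0" "2 - 2 * real n \<noteq> 0" "sqrt (real n) \<noteq> 0"
    using n4 by (auto simp: a_def b_def)
  ultimately show False by simp
qed

lemma has_distance_C: "has_distance n C 2"
  unfolding has_distance_def
proof (intro conjI allI impI)
  show "\<forall>A\<in>quantum_metric n (real 2 - 1). detects n C A"
    using dim_and_detection(2) by simp
next
  fix d :: nat assume d: "1 \<le> d" and det: "\<forall>A\<in>quantum_metric n (real d - 1). detects n C A"
  show "d \<le> 2"
  proof (rule ccontr)
    assume "\<not> d \<le> 2"
    then have "2 \<le> d - 1" by linarith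
    from HE_in_quantum_metric[OF this] have "H_op n * E_op n \<in> quantum_metric n (real d - 1)"
      unfolding of_nat_diff[OF d] by simp
    with det not_detects_HE show False by blast
  qed
qed simp

lemmas code_properties = quantum_code_C[unfolded C_def] has_distance_C[unfolded C_def]
  dim_and_detection(1)[unfolded C_def]

end

section \<open>The extra vectors and the six residue classes\<close>

lemma ket_zero_eq: "ket n 0 = two_kets n (1, 0, 0, 0)"
  by (intro eq_vecI) (auto simp: ket_def)

lemma phi3_eq: "phi3 n = two_kets n (1 / sqrt 2, 3, 1 / sqrt 2, - 3)"
  by (intro eq_vecI) (auto simp: phi3_def ket_def)

lemma block_code_empty:
  "4 \<le> m \<Longrightarrow> 1 \<le> N \<Longrightarrow> int n + 6 = m + 6 * int N \<Longrightarrow> block_code n N m {}"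
  by (rule block_code.intro) simp_all

text \<open>The second ket of the tuple is a dummy with amplitude 0; its weight 0 is a genuine
  weight because \<open>n\<close> is even.\<close>

lemma block_code_ket_zero:
  assumes "6 \<le> m" "1 \<le> N" "int n + 6 = m + 6 * int N" "even n"
  shows "block_code n N m {(1, 0, 0, 0)}"
proof (rule block_code.intro)
  fix x :: two_ket assume "x \<in> {(1, 0, 0, 0)}"
  then have x: "x = (1, 0, 0, 0)" by simp
  show "in_weights n x" using assms by (simp add: x mem_weights_iff)
  show "supported_below (m - 4) x" using assms by (simp add: x)
qed (use assms in \<open>auto simp: unmixed_def\<close>)

text \<open>Equal amplitudes at opposite weights cancel the expectation of \<open>H\<close>, and a
  shift by 2 cannot bridge the distance 6 between them.\<close>

lemma block_code_phi3:
  assumes "9 \<le> m" "1 \<le> N" "int n + 6 = m + 6 * int N" "odd n"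
  shows "block_code n N m {(1 / sqrt 2, 3, 1 / sqrt 2, - 3)}"
proof (rule block_code.intro)
  fix x :: two_ket assume "x \<in> {(1 / sqrt 2, 3, 1 / sqrt 2, - 3)}"
  then have x: "x = (1 / sqrt 2, 3, 1 / sqrt 2, - 3)" by simp
  have "3 \<le> int n" using assms by linarith
  then show "in_weights n x" using assms(4) by (simp add: x mem_weights_iff)
  show "supported_below (m - 4) x" using assms by (simp add: x)
next
  fix x y :: two_ket
  assume "x \<in> {(1 / sqrt 2, 3, 1 / sqrt 2, - 3)}" "y \<in> {(1 / sqrt 2, 3, 1 / sqrt 2, - 3)}"
  then have "x = (1 / sqrt 2, 3, 1 / sqrt 2, - 3)" "y = (1 / sqrt 2, 3, 1 / sqrt 2, - 3)" by simp_all
  then show "unmixed n x y" by (simp add: unmixed_def)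
qed (use assms in auto)

lemma su2_code_eq:
  "n mod 6 = 0 \<Longrightarrow> su2_code n = vspan n (blocks_down_to n 6 \<union> two_kets n ` {(1, 0, 0, 0)})"
  "n mod 6 = 1 \<Longrightarrow> su2_code n = vspan n (blocks_down_to n 7 \<union> two_kets n ` {})"
  "n mod 6 = 2 \<Longrightarrow> su2_code n = vspan n (blocks_down_to n 8 \<union> two_kets n ` {(1, 0, 0, 0)})"
  "n mod 6 = 3 \<Longrightarrow> su2_code n = vspan n (blocks_down_to n 9 \<union> two_kets n ` {(1 / sqrt 2, 3, 1 / sqrt 2, - 3)})"
  "n mod 6 = 4 \<Longrightarrow> su2_code n = vspan n (blocks_down_to n 4 \<union> two_kets n ` {})"
  "n mod 6 = 5 \<Longrightarrow> su2_code n = vspan n (blocks_down_to n 5 \<union> two_kets n ` {})"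
  unfolding su2_code_def ket_zero_eq phi3_eq
  by (simp_all del: two_kets.simps)

theorem mainTheorem4:
  fixes n :: nat
  assumes "n \<ge> 4"
  shows "quantum_code n (su2_code n) \<and>
    has_distance n (su2_code n) 2 \<and>
    (n mod 6 = 0 \<longrightarrow> real (subdim n (su2_code n)) = 2 * (real n / 6) + 1) \<and>
    (n mod 6 = 1 \<longrightarrow> real (subdim n (su2_code n)) = 2 * ((real n - 1) / 6)) \<and>
    (n mod 6 = 2 \<longrightarrow> real (subdim n (su2_code n)) = 2 * ((real n - 2) / 6) + 1) \<and>
    (n mod 6 = 3 \<longrightarrow> real (subdim n (su2_code n)) = 2 * ((real n - 3) / 6) + 1) \<and>
    (n mod 6 = 4 \<longrightarrow> real (subdim n (su2_code n)) = 2 * ((real n + 2) / 6)) \<and>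
    (n mod 6 = 5 \<longrightarrow> real (subdim n (su2_code n)) = 2 * ((real n + 1) / 6))"
proof -
  define q where "q = n div 6"
  have n: "n = 6 * q + n mod 6" by (simp add: q_def)
  consider "n mod 6 = 0" | "n mod 6 = 1" | "n mod 6 = 2" | "n mod 6 = 3" | "n mod 6 = 4" | "n mod 6 = 5"
    by linarith
  then show ?thesis
  proof cases
    case 1
    \<comment> \<open>For residues 0 to 3 the lowest index is 6 plus the residue, giving
      \<open>q\<close> blocks; \<open>n \<ge> 4\<close> ensures that there is at least one.\<close>
    with n assms have "block_code n q 6 {(1, 0, 0, 0)}"
      by (intro block_code_ket_zero) presburger+
    from block_code.code_properties[OF this] 1 n show ?thesis
      by (simp add: su2_code_eq del: two_kets.simps)
  next
    case 2
    with n assms have "block_code n q 7 {}"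
      by (intro block_code_empty) presburger+
    from block_code.code_properties[OF this] 2 n show ?thesis
      by (simp add: su2_code_eq del: two_kets.simps)
  next
    case 3
    with n assms have "block_code n q 8 {(1, 0, 0, 0)}"
      by (intro block_code_ket_zero) presburger+
    from block_code.code_properties[OF this] 3 n show ?thesis
      by (simp add: su2_code_eq del: two_kets.simps)
  next
    case 4
    with n assms have "block_code n q 9 {(1 / sqrt 2, 3, 1 / sqrt 2, - 3)}"
      by (intro block_code_phi3) presburger+
    from block_code.code_properties[OF this] 4 n show ?thesis
      by (simp add: su2_code_eq del: two_kets.simps)
  next
    case 5
    \<comment> \<open>For residues 4 and 5 the residue itself is a block index, whence one block
      more.\<close>
    with n have "block_code n (q + 1) 4 {}"
      by (intro block_code_empty) presburger+
    from block_code.code_properties[OF this] 5 n show ?thesis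
      by (simp add: su2_code_eq del: two_kets.simps)
  next
    case 6
    with n have "block_code n (q + 1) 5 {}"
      by (intro block_code_empty) presburger+
    from block_code.code_properties[OF this] 6 n show ?thesis
      by (simp add: su2_code_eq del: two_kets.simps)
  qed
qed

end
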